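(* Let $m\geq 2$ be an integer and let $n$ be the number of distinct prime divisors of $m$. If $\mathrm{ZT}(\mathbb{Z}_m)$ is connected, then its metric dimension is $$\dim_M(\mathrm{ZT}(\mathbb{Z}_m))=\begin{cases} m-\varphi(m)-\tau(m)+n+1, & n\geq 2,\\ m-\varphi(m)-\tau(m)+1, & n=1.\end{cases}$$
   Context: $\mathbb{Z}_m$ is the ring of integers modulo $m$, and $Z(\mathbb{Z}_m)$ is its set of zero-divisors, with $0$ included. The total zero-divisor graph $\mathrm{ZT}(\mathbb{Z}_m)$ is the simple graph whose vertices are the nonzero zero-divisors of $\mathbb{Z}_m$, with distinct vertices $u,v$ adjacent if and only if $uv=0$ and $u+v\in Z(\mathbb{Z}_m)$. A connected graph has at least one vertex. $\varphi$ is Euler's totient function and $\tau(m)$ is the number of positive divisors of $m$. The metric dimension $\dim_M(G)$ of a connected graph $G$ is the minimum cardinality of a resolving set, i.e. a set $S$ of vertices such that all other vertices are uniquely determined by their distances to the vertices in $S$. *)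

theory Defs
  imports
    "HOL-Number_Theory.Residues"
    "HOL-Number_Theory.Totient"
    "Graph_Theory.Graph_Theory"
begin

text \<open>In a nonzero commutative ring this set contains \<open>\<zero>\<close>.\<close>

definition zero_divisors :: "('a, 'b) ring_scheme \<Rightarrow> 'a set" where
  "zero_divisors R =
     {x \<in> carrier R. \<exists>y \<in> carrier R. y \<noteq> \<zero>\<^bsub>R\<^esub> \<and> x \<otimes>\<^bsub>R\<^esub> y = \<zero>\<^bsub>R\<^esub>}"

text \<open>An undirected edge \<open>{u, v}\<close> is represented by the two arcs \<open>(u, v)\<close> and \<open>(v, u)\<close>.\<close>

definition total_zero_divisor_graph :: "('a, 'b) ring_scheme \<Rightarrow> 'a pair_pre_digraph" where
  "total_zero_divisor_graph R =
     (let V = zero_divisors R - {\<zero>\<^bsub>R\<^esub>} in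
      \<lparr> pverts = V,
        parcs = {(u, v). u \<in> V \<and> v \<in> V \<and> u \<noteq> v \<and>
                   u \<otimes>\<^bsub>R\<^esub> v = \<zero>\<^bsub>R\<^esub> \<and> u \<oplus>\<^bsub>R\<^esub> v \<in> zero_divisors R} \<rparr>)"

lemma pair_graph_total_zero_divisor_graph:
  assumes "cring R" and "finite (carrier R)"
  shows "pair_graph (total_zero_divisor_graph R)"
proof -
  interpret cring R by fact
  let ?G = "total_zero_divisor_graph R"
  have sub: "pverts ?G \<subseteq> carrier R"
    by (auto simp: total_zero_divisor_graph_def zero_divisors_def Let_def)
  then have fin: "finite (pverts ?G)"
    using assms(2) by (rule finite_subset)
  have "parcs ?G \<subseteq> pverts ?G \<times> pverts ?G"
    by (auto simp: total_zero_divisor_graph_def Let_def)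
  then have fin': "finite (parcs ?G)"
    using fin by (meson finite_SigmaI finite_subset)
  have comm: "u \<otimes>\<^bsub>R\<^esub> v = v \<otimes>\<^bsub>R\<^esub> u" "u \<oplus>\<^bsub>R\<^esub> v = v \<oplus>\<^bsub>R\<^esub> u"
    if "u \<in> zero_divisors R" "v \<in> zero_divisors R" for u v
    using that by (auto simp: zero_divisors_def m_comm a_comm)
  have "sym (parcs ?G)"
    by (rule symI) (auto simp: total_zero_divisor_graph_def Let_def comm)
  then have sym: "symmetric ?G"
    by (simp add: symmetric_def)
  show ?thesis
    using fin fin' sym
    by unfold_locales (auto simp: total_zero_divisor_graph_def Let_def)
qed

text \<open>The number of arcs of a shortest walk, and \<open>\<infinity>\<close> if there is no walk.\<close>

definition graph_dist :: "('a, 'b) pre_digraph \<Rightarrow> 'a \<Rightarrow> 'a \<Rightarrow> ereal" where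
  "graph_dist G u v = wf_digraph.\<mu> G (\<lambda>_. 1) u v"

definition resolving_set :: "('a, 'b) pre_digraph \<Rightarrow> 'a set \<Rightarrow> bool" where
  "resolving_set G S \<longleftrightarrow> S \<subseteq> verts G \<and>
     (\<forall>u \<in> verts G - S. \<forall>v \<in> verts G.
        (\<forall>s \<in> S. graph_dist G u s = graph_dist G v s) \<longrightarrow> u = v)"

definition metric_dimension :: "('a, 'b) pre_digraph \<Rightarrow> nat" where
  "metric_dimension G = (LEAST k. \<exists>S. finite S \<and> resolving_set G S \<and> card S = k)"

end

theory Submission
  imports Defs
begin

text \<open>Call two vertices twins if they have the same neighbours outside the pair. Twins are at equal
  distance from every other vertex, so a resolving set omits at most one vertex of each twin class.
  Conversely, omitting one vertex of each class leaves a resolving set if the omitted vertices have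
  different neighbours among the rest. The metric dimension is then the number of vertices minus
  the number of classes (\<open>metric_dimension_twin_transversal\<close>); no distance other than \<open>0\<close> and \<open>1\<close>
  has to be computed.

  Distinct vertices \<open>a\<close> and \<open>b\<close> of the graph of \<open>\<int>/m\<close> are adjacent iff \<open>m\<close> divides \<open>a * b\<close> and some
  prime divides \<open>a\<close>, \<open>b\<close> and \<open>m\<close>. So adjacency depends only on \<open>gcd a m\<close> and \<open>gcd b m\<close>, and each vertex is
  a twin of a divisor \<open>d\<close> of \<open>m\<close> with \<open>1 < d < m\<close>. Connectedness forces every prime divisor \<open>p\<close> of \<open>m\<close> to
  satisfy \<open>p\<^sup>2 dvd m\<close>, since otherwise the graph has no vertex, or \<open>p\<close> is an isolated vertex among
  several (\<open>connected_imp_prime_square_dvd\<close>).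

  There is one coincidence per prime. Let \<open>p ^ a\<close> be the exact power of \<open>p\<close> in \<open>m\<close>, and suppose it is
  not \<open>m\<close> itself. The complementary divisor \<open>m div p ^ a\<close> annihilates \<open>p ^ a\<close> but is coprime to it, so a
  neighbour of \<open>p ^ a\<close> needs an additional factor \<open>p\<close>, which makes it a neighbour of \<open>p ^ (a - 1)\<close>, again
  a vertex because \<open>a \<ge> 2\<close>. Hence \<open>p ^ a\<close> and \<open>p ^ (a - 1)\<close> are twins (\<open>zt_rel_full_prime_power\<close>). There
  are no further coincidences (\<open>twin_representatives_separated\<close>), so the classes correspond to the divisors of \<open>m\<close> other than
  \<open>1\<close>, \<open>m\<close> and the full prime powers. If \<open>m\<close> is a prime power, then \<open>m\<close> is its only full prime power; this is
  why the term \<open>n\<close> appears only for \<open>n \<ge> 2\<close>.\<close>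

section \<open>Distances and twins\<close>

context pair_graph
begin

lemma awalk_cost_const_1: "awalk_cost (\<lambda>_. 1) p = real (length p)"
  by (induct p) auto

lemma graph_dist_le_length:
  assumes "awalk u p v"
  shows "graph_dist G u v \<le> ereal (real (length p))"
  using min_cost_le_walk_cost[OF assms, of "\<lambda>_. 1"]
  by (simp add: graph_dist_def awalk_cost_const_1)

lemma graph_dist_less_iff:
  "graph_dist G u v < x \<longleftrightarrow> (\<exists>p. awalk u p v \<and> ereal (real (length p)) < x)"
  by (simp add: graph_dist_def \<mu>_def awalk_cost_const_1 Inf_less_iff)

lemma graph_dist_eq_0_iff:
  assumes "u \<in> pverts G"
  shows "graph_dist G u v = 0 \<longleftrightarrow> u = v"
proof
  assume "graph_dist G u v = 0"
  then have "graph_dist G u v < ereal 1"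
    by simp
  then obtain p where "awalk u p v" "length p < 1"
    unfolding graph_dist_less_iff by auto
  then show "u = v"
    by (simp add: awalk_Nil_iff)
next
  assume "u = v"
  then have "graph_dist G u v \<le> 0"
    using graph_dist_le_length[of u "[]" v] assms by (simp add: awalk_Nil_iff zero_ereal_def)
  moreover have "graph_dist G u v \<ge> 0"
    using graph_dist_less_iff[of u v 0] by (meson ereal_less(2) ereal_less_eq(5) not_le of_nat_0_le_iff)
  ultimately show "graph_dist G u v = 0"
    by simp
qed

lemma graph_dist_eq_1_iff:
  assumes "u \<noteq> v"
  shows "graph_dist G u v = 1 \<longleftrightarrow> (u, v) \<in> parcs G"
proof
  assume "graph_dist G u v = 1"
  then have "graph_dist G u v < ereal 2"
    by simp
  then obtain p where p: "awalk u p v" "length p < 2"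
    unfolding graph_dist_less_iff by auto
  moreover have "p \<noteq> []"
    using p assms by (auto simp: awalk_Nil_iff)
  ultimately obtain e where "p = [e]"
    by (cases p) (auto simp: less_Suc_eq numeral_2_eq_2)
  with p show "(u, v) \<in> parcs G"
    by (cases e) (auto simp: awalk_Cons_iff awalk_Nil_iff)
next
  assume arc: "(u, v) \<in> parcs G"
  then have "awalk u [(u, v)] v"
    by (auto simp: awalk_Cons_iff awalk_Nil_iff in_arcsD1 in_arcsD2)
  then have "graph_dist G u v \<le> 1"
    using graph_dist_le_length[of u "[(u, v)]" v] by (simp add: one_ereal_def)
  moreover have "\<not> graph_dist G u v < 1"
  proof
    assume "graph_dist G u v < 1"
    then obtain p where "awalk u p v" "length p < 1"
      unfolding graph_dist_less_iff by auto
    then show False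
      using assms by (simp add: awalk_Nil_iff)
  qed
  ultimately show "graph_dist G u v = 1"
    by simp
qed

definition twins :: "'a \<Rightarrow> 'a \<Rightarrow> bool" where
  "twins u v \<longleftrightarrow> (\<forall>x. x \<noteq> u \<longrightarrow> x \<noteq> v \<longrightarrow> ((u, x) \<in> parcs G \<longleftrightarrow> (v, x) \<in> parcs G))"

lemma twins_sym: "twins u v \<Longrightarrow> twins v u"
  by (auto simp: twins_def)

text \<open>A walk from \<open>u\<close> can be rerouted at its first arc so that it starts at the twin \<open>v\<close>,
  unless that arc already leads to \<open>v\<close>, in which case dropping it gives a shorter walk.\<close>

lemma graph_dist_twin_le:
  assumes "twins u v" "v \<in> pverts G" "s \<noteq> u"
  shows "graph_dist G v s \<le> graph_dist G u s"
proof (rule ccontr)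
  assume "\<not> graph_dist G v s \<le> graph_dist G u s"
  then have "graph_dist G u s < graph_dist G v s"
    by simp
  then obtain p where p: "awalk u p s" "ereal (real (length p)) < graph_dist G v s"
    unfolding graph_dist_less_iff by auto
  from p(1) assms(3) obtain x q where xq: "p = (u, x) # q" "(u, x) \<in> parcs G" "awalk x q s"
    by (cases p) (auto simp: awalk_Cons_iff awalk_Nil_iff)
  have "\<exists>q'. awalk v q' s \<and> length q' \<le> length p"
  proof (cases "x = v")
    case True
    with xq show ?thesis by auto
  next
    case False
    moreover have "x \<noteq> u"
      using xq(2) no_loops' by blast
    ultimately have "(v, x) \<in> parcs G"
      using xq(2) assms(1) by (auto simp: twins_def)
    with xq show ?thesis
      by (intro exI[of _ "(v, x) # q"]) (auto simp: awalk_Cons_iff)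
  qed
  then obtain q' where "awalk v q' s" "length q' \<le> length p"
    by blast
  with graph_dist_le_length[of v q' s] p(2) show False
    by (meson ereal_less_eq(3) not_le of_nat_mono order_trans)
qed

lemma graph_dist_twin_eq:
  assumes "twins u v" "u \<in> pverts G" "v \<in> pverts G" "s \<noteq> u" "s \<noteq> v"
  shows "graph_dist G u s = graph_dist G v s"
  using assms graph_dist_twin_le twins_sym by (intro antisym) auto

text \<open>The labels \<open>f\<close> group the vertices into classes of twins. A resolving set omits at most one
  vertex of each class, because two omitted twins have equal distances to everything else. So the
  complement of a transversal \<open>K\<close> of the classes is as small as a resolving set can be, and it is
  resolving once adjacency to it (that is, distance one) tells the elements of \<open>K\<close> apart.\<close>

lemma metric_dimension_twin_transversal:
  fixes f :: "'a \<Rightarrow> 'b"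
  assumes twins: "\<And>u v. u \<in> pverts G \<Longrightarrow> v \<in> pverts G \<Longrightarrow> f u = f v \<Longrightarrow> twins u v"
    and K: "K \<subseteq> pverts G" "f ` pverts G \<subseteq> f ` K"
    and sep: "\<And>u v. u \<in> K \<Longrightarrow> v \<in> K \<Longrightarrow> u \<noteq> v \<Longrightarrow>
        \<exists>s \<in> pverts G - K. ((u, s) \<in> parcs G) \<noteq> ((v, s) \<in> parcs G)"
  shows "metric_dimension G = card (pverts G) - card K"
proof -
  have finK: "finite K"
    using K(1) pair_finite_verts finite_subset by blast
  have "resolving_set G (pverts G - K)"
    unfolding resolving_set_def with_proj_simps
  proof (intro conjI ballI impI)
    fix u v
    assume u: "u \<in> pverts G - (pverts G - K)" and v: "v \<in> pverts G"
      and eq: "\<forall>s\<in>pverts G - K. graph_dist G u s = graph_dist G v s"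
    show "u = v"
    proof (cases "v \<in> K")
      case True
      show ?thesis
      proof (rule ccontr)
        assume "u \<noteq> v"
        then obtain s where s: "s \<in> pverts G - K"
          and ne: "((u, s) \<in> parcs G) \<noteq> ((v, s) \<in> parcs G)"
          using sep[of u v] u True by auto
        have "s \<noteq> u" "s \<noteq> v"
          using s u True by auto
        then have "((u, s) \<in> parcs G) = ((v, s) \<in> parcs G)"
          using eq s graph_dist_eq_1_iff by metis
        with ne show False by simp
      qed
    next
      case False
      then have "graph_dist G u v = graph_dist G v v"
        using eq v by auto
      then have "graph_dist G u v = 0"
        using graph_dist_eq_0_iff[OF v, of v] by simp
      then show ?thesis
        using graph_dist_eq_0_iff[of u v] u by auto
    qed
  qed auto
  moreover have "card (pverts G - K) = card (pverts G) - card K"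
    using K(1) finK by (rule card_Diff_subset[rotated])
  moreover have "card (pverts G) - card K \<le> card S" if S: "resolving_set G S" for S
  proof -
    have sub: "S \<subseteq> pverts G"
      using S by (simp add: resolving_set_def)
    have "inj_on f (pverts G - S)"
    proof (rule inj_onI)
      fix u v
      assume uv: "u \<in> pverts G - S" "v \<in> pverts G - S" "f u = f v"
      then have "twins u v"
        using twins by blast
      then have "graph_dist G u s = graph_dist G v s" if "s \<in> S" for s
        using uv that by (intro graph_dist_twin_eq) auto
      with S uv show "u = v"
        by (auto simp: resolving_set_def)
    qed
    then have "card (pverts G - S) = card (f ` (pverts G - S))"
      by (simp add: card_image)
    also have "\<dots> \<le> card (f ` K)"
      using K(2) finK by (intro card_mono) auto
    also have "\<dots> \<le> card K"
      using finK by (rule card_image_le)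
    finally show ?thesis
      using card_Diff_subset[of S "pverts G"] sub pair_finite_verts finite_subset[OF sub] by simp
  qed
  ultimately show ?thesis
    unfolding metric_dimension_def using pair_finite_verts
    by (intro Least_equality exI[of _ "pverts G - K"]) auto
qed

end

section \<open>The graph of \<open>\<int>/m\<close> in terms of natural numbers\<close>

definition nonzero_nonunits :: "nat \<Rightarrow> nat set" where
  "nonzero_nonunits m = {a. 0 < a \<and> a < m \<and> \<not> coprime a m}"

text \<open>This is the adjacency of \<open>a\<close> and \<open>b\<close> without the requirement \<open>a \<noteq> b\<close>. Allowing \<open>a = b\<close> makes
  it a function of \<open>gcd a m\<close> and \<open>gcd b m\<close> alone, and vertices related to the same numbers are twins.\<close>

definition zt_rel :: "nat \<Rightarrow> nat \<Rightarrow> nat \<Rightarrow> bool" where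
  "zt_rel m a b \<longleftrightarrow> m dvd a * b \<and> \<not> coprime (gcd a b) m"

lemma zt_rel_prime_power_iff:
  assumes "prime p" "p dvd m"
  shows "zt_rel m (p ^ Suc k) b \<longleftrightarrow> m dvd p ^ Suc k * b \<and> p dvd b"
proof (cases "p dvd b")
  case True
  then have "p dvd gcd (p ^ Suc k) b"
    by simp
  then have "\<not> coprime (gcd (p ^ Suc k) b) m"
    using assms by (meson coprime_common_divisor not_prime_unit)
  with True show ?thesis
    by (simp add: zt_rel_def)
next
  case False
  then have "coprime p b"
    using assms(1) by (rule prime_imp_coprime[rotated])
  then have "gcd (p ^ Suc k) b = 1"
    using coprime_iff_gcd_eq_1 coprime_power_left_iff by blast
  with False show ?thesis
    by (simp add: zt_rel_def)
qed

lemma not_coprime_iff_zero_divisor: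
  fixes a m :: nat
  assumes "0 < m"
  shows "\<not> coprime a m \<longleftrightarrow> (\<exists>y. 0 < y \<and> y < m \<and> m dvd a * y)"
proof
  assume "\<not> coprime a m"
  then have g: "gcd a m \<noteq> 1"
    by (simp add: coprime_iff_gcd_eq_1)
  have gpos: "gcd a m > 0"
    using assms by simp
  have lt: "m div gcd a m < m"
    using g gpos assms by (intro div_less_dividend) linarith+
  have "m dvd a * (m div gcd a m)"
  proof -
    have "a * (m div gcd a m) = (a div gcd a m) * m"
      by (metis div_mult_swap dvd_div_mult gcd_dvd1 gcd_dvd2)
    then show ?thesis by simp
  qed
  moreover have "0 < m div gcd a m"
    using assms gpos by (simp add: div_greater_zero_iff)
  ultimately show "\<exists>y. 0 < y \<and> y < m \<and> m dvd a * y"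
    using lt by blast
next
  assume "\<exists>y. 0 < y \<and> y < m \<and> m dvd a * y"
  then show "\<not> coprime a m"
    by (metis coprime_commute coprime_dvd_mult_right_iff nat_dvd_not_less)
qed

lemma zero_divisors_residue_ring:
  assumes "m \<ge> 2"
  shows "zero_divisors (residue_ring (int m)) = int ` {a. a < m \<and> \<not> coprime a m}"
proof -
  have "int a \<in> zero_divisors (residue_ring (int m)) \<longleftrightarrow> \<not> coprime a m" if "a < m" for a
  proof -
    have "(\<exists>y\<in>{0..int m - 1}. y \<noteq> 0 \<and> (int a * y) mod int m = 0) \<longleftrightarrow>
        (\<exists>y. 0 < y \<and> y < m \<and> m dvd a * y)" (is "?L \<longleftrightarrow> ?R")
    proof
      assume ?L
      then obtain y where "0 \<le> y" "y < int m" "y \<noteq> 0" "(int a * y) mod int m = 0"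
        by auto
      moreover from this obtain z where "y = int z"
        using nonneg_int_cases by blast
      ultimately show ?R
        by (intro exI[of _ z]) (auto simp flip: of_nat_mult of_nat_mod)
    next
      assume ?R
      then obtain y where "0 < y" "y < m" "m dvd a * y"
        by auto
      then show ?L
        by (intro bexI[of _ "int y"]) (auto simp flip: of_nat_mult of_nat_mod)
    qed
    then show ?thesis
      using that not_coprime_iff_zero_divisor[of m a] assms
      by (simp add: zero_divisors_def residue_ring_def)
  qed
  moreover have "\<exists>a<m. x = int a" if "x \<in> zero_divisors (residue_ring (int m))" for x
    using that by (intro exI[of _ "nat x"]) (auto simp: zero_divisors_def residue_ring_def)
  ultimately show ?thesis
    by (auto simp: image_iff) blast
qed

lemma pverts_residue_ring:
  assumes "m \<ge> 2"
  shows "pverts (total_zero_divisor_graph (residue_ring (int m))) = int ` nonzero_nonunits m"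
  using zero_divisors_residue_ring[OF assms]
  by (auto simp: total_zero_divisor_graph_def nonzero_nonunits_def residue_ring_def)

text \<open>If \<open>m\<close> divides \<open>a * b\<close>, then every prime divisor of \<open>m\<close> divides \<open>a\<close> or \<open>b\<close>; one that divides
  \<open>a + b\<close> thus divides both. This turns the condition on \<open>a + b\<close> into one on \<open>gcd a b\<close>.\<close>

lemma coprime_add_iff_coprime_gcd:
  fixes a b m :: nat
  assumes "m dvd a * b"
  shows "coprime (a + b) m \<longleftrightarrow> coprime (gcd a b) m"
proof
  assume "coprime (a + b) m"
  then show "coprime (gcd a b) m"
    by (rule coprime_divisors[rotated 2]) auto
next
  assume gcd: "coprime (gcd a b) m"
  show "coprime (a + b) m"
  proof (rule ccontr)
    assume "\<not> coprime (a + b) m"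
    then obtain p where p: "prime p" "p dvd a + b" "p dvd m"
      by (metis coprime_iff_gcd_eq_1 gcd_greatest_iff prime_factor_nat)
    then have "p dvd a \<or> p dvd b"
      using assms by (meson dvd_trans prime_dvd_mult_iff)
    then have "p dvd gcd a b"
      using p(2) by (auto simp: dvd_add_right_iff dvd_add_left_iff)
    with gcd p show False
      by (meson coprime_common_divisor not_prime_unit)
  qed
qed

lemma parcs_residue_ring:
  assumes "m \<ge> 2" "a \<in> nonzero_nonunits m" "b \<in> nonzero_nonunits m"
  shows "(int a, int b) \<in> parcs (total_zero_divisor_graph (residue_ring (int m))) \<longleftrightarrow>
      a \<noteq> b \<and> zt_rel m a b"
proof -
  have zd: "(int a + int b) mod int m \<in> zero_divisors (residue_ring (int m)) \<longleftrightarrow>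
      \<not> coprime (a + b) m"
    using assms(1) by (auto simp: zero_divisors_residue_ring image_iff simp flip: of_nat_add of_nat_mod)
  have V: "int a \<in> zero_divisors (residue_ring (int m)) - {0}"
       "int b \<in> zero_divisors (residue_ring (int m)) - {0}"
    using assms by (auto simp: zero_divisors_residue_ring nonzero_nonunits_def)
  have "(int a * int b) mod int m = 0 \<longleftrightarrow> m dvd a * b"
    by (auto simp flip: of_nat_mult of_nat_mod)
  then show ?thesis
    using V zd coprime_add_iff_coprime_gcd[of m a b]
    by (auto simp: total_zero_divisor_graph_def residue_ring_def zt_rel_def)
qed

lemma pair_graph_residue_ring:
  assumes "m \<ge> 2"
  shows "pair_graph (total_zero_divisor_graph (residue_ring (int m)))"
proof (rule pair_graph_total_zero_divisor_graph)
  interpret residues "int m" "residue_ring (int m)"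
    using assms by unfold_locales auto
  show "cring (residue_ring (int m))"
    by (rule cring)
  show "finite (carrier (residue_ring (int m)))"
    by (simp add: residue_ring_def)
qed

section \<open>Connectedness excludes unitary primes\<close>

text \<open>If \<open>m = p\<close>, there are no vertices. Otherwise a prime \<open>p\<close> dividing \<open>m\<close> exactly once is a vertex
  without neighbours, because a neighbour would be a multiple of both \<open>p\<close> and \<open>m div p\<close>, hence of \<open>m\<close>;
  and a prime divisor of \<open>m div p\<close> is a second vertex.\<close>

lemma connected_imp_prime_square_dvd:
  assumes m: "m \<ge> 2"
    and conn: "Digraph_Component.connected
        (with_proj (total_zero_divisor_graph (residue_ring (int m))))"
    and p: "prime p" "p dvd m"
  shows "p ^ 2 dvd m"
proof (rule ccontr)
  assume nsq: "\<not> p ^ 2 dvd m"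
  let ?G = "total_zero_divisor_graph (residue_ring (int m))"
  interpret pair_graph ?G
    using m by (rule pair_graph_residue_ring)
  define c where "c = m div p"
  have mc: "m = p * c"
    using p(2) by (simp add: c_def)
  have cop: "coprime p c"
    using nsq p(1) mc by (metis mult_dvd_mono dvd_refl power2_eq_square prime_imp_coprime)
  have ne: "pverts ?G \<noteq> {}"
    and reach: "\<And>u v. u \<in> pverts ?G \<Longrightarrow> v \<in> pverts ?G \<Longrightarrow> u \<rightarrow>\<^sup>*\<^bsub>with_proj (mk_symmetric ?G)\<^esub> v"
    using conn by (auto simp: connected_def strongly_connected_def mk_symmetric_def)
  have "c \<noteq> 1"
  proof
    assume "c = 1"
    then have "prime m"
      using mc p(1) by simp
    then have "coprime a m" if "0 < a" "a < m" for a
      using that nat_dvd_not_less prime_imp_coprime coprime_commute by blast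
    then have "nonzero_nonunits m = {}"
      by (auto simp: nonzero_nonunits_def)
    with ne m show False
      by (simp add: pverts_residue_ring)
  qed
  then obtain q where q: "prime q" "q dvd c"
    using prime_factor_nat by blast
  have "q \<noteq> p"
    using cop q by (metis coprime_common_divisor dvd_refl not_prime_unit)
  have "c > 1"
    using \<open>c \<noteq> 1\<close> m mc by (cases c) auto
  have "p > 1"
    using p(1) prime_gt_1_nat by blast
  have "p < m" "c < m"
    using mc \<open>c > 1\<close> \<open>p > 1\<close> by auto
  then have "q < m"
    using q(2) \<open>c > 1\<close> by (meson dvd_imp_le le_less_trans less_trans zero_less_one)
  have pV: "p \<in> nonzero_nonunits m"
    using p \<open>p < m\<close> \<open>p > 1\<close>
    by (auto simp: nonzero_nonunits_def coprime_absorb_left)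
  have qV: "q \<in> nonzero_nonunits m"
    using q \<open>q < m\<close> prime_gt_0_nat[OF q(1)] mc
    by (auto simp: nonzero_nonunits_def coprime_absorb_left)
  have "int p \<rightarrow>\<^sup>*\<^bsub>with_proj (mk_symmetric ?G)\<^esub> int q"
    using reach pV qV m by (simp add: pverts_residue_ring)
  then obtain w where w: "(int p, w) \<in> parcs (mk_symmetric ?G)"
    using \<open>q \<noteq> p\<close> by (auto elim: pre_digraph.converse_reachable_cases)
  then have arc: "(int p, w) \<in> parcs ?G"
    using arcs_symmetric by (auto simp: mk_symmetric_def)
  moreover from arc obtain b where b: "w = int b" "b \<in> nonzero_nonunits m"
    using in_arcsD2 m by (auto simp: pverts_residue_ring)
  ultimately have "zt_rel m p b"
    using m pV by (simp add: parcs_residue_ring)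
  then have "m dvd p * b" "p dvd b"
    using zt_rel_prime_power_iff[OF p, of 0 b] by simp_all
  moreover from this have "c dvd b"
    using mc \<open>p > 1\<close> by simp
  ultimately have "m dvd b"
    using cop mc by (simp add: divides_mult)
  with b(2) show False
    by (auto simp: nonzero_nonunits_def dest: dvd_imp_le)
qed


section \<open>Twin classes and divisors\<close>

definition full_prime_powers :: "nat \<Rightarrow> nat set" where
  "full_prime_powers m = (\<lambda>p. p ^ multiplicity p m) ` prime_factors m"

definition twin_representatives :: "nat \<Rightarrow> nat set" where
  "twin_representatives m = {d. d dvd m} - {1, m} - full_prime_powers m"

lemma zt_rel_commute: "zt_rel m a b \<longleftrightarrow> zt_rel m b a"
  by (simp add: zt_rel_def ac_simps)

lemma zt_rel_gcd_left: "zt_rel m (gcd a m) b \<longleftrightarrow> zt_rel m a b"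
proof -
  have "gcd a m * b = gcd (a * b) (m * b)"
    by (metis gcd_mult_distrib_nat mult.commute)
  then have "m dvd gcd a m * b \<longleftrightarrow> m dvd a * b"
    by simp
  moreover have "gcd (gcd (gcd a m) b) m = gcd (gcd a b) m"
    by (simp add: ac_simps)
  ultimately show ?thesis
    unfolding zt_rel_def coprime_iff_gcd_eq_1 by metis
qed

text \<open>Both sides say that \<open>p * c\<close> divides \<open>b\<close>: on the left the factor \<open>p\<close> comes from the common prime
  divisor, on the right from the annihilation.\<close>

lemma zt_rel_full_prime_power:
  assumes "prime p" "m = p ^ Suc (Suc k) * c" "coprime p c"
  shows "zt_rel m (p ^ Suc (Suc k)) b \<longleftrightarrow> zt_rel m (p ^ Suc k) b"
proof -
  have "p > 0"
    using assms(1) prime_gt_0_nat by blast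
  have "zt_rel m (p ^ Suc (Suc k)) b \<longleftrightarrow> c dvd b \<and> p dvd b"
    using \<open>p > 0\<close> assms by (subst zt_rel_prime_power_iff) auto
  also have "\<dots> \<longleftrightarrow> p * c dvd b"
    using assms(3) by (auto intro: divides_mult dest: dvd_mult_left dvd_mult_right)
  also have "\<dots> \<longleftrightarrow> p * c dvd b \<and> p dvd b"
    by (auto dest: dvd_mult_left)
  also have "\<dots> \<longleftrightarrow> zt_rel m (p ^ Suc k) b"
  proof -
    have "m = p ^ Suc k * (p * c)"
      using assms(2) by simp
    then have "m dvd p ^ Suc k * b \<longleftrightarrow> p * c dvd b"
      using \<open>p > 0\<close> by (simp only: nat_mult_dvd_cancel_disj) simp
    moreover have "p dvd m"
      using assms(2) by simp
    ultimately show ?thesis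
      using assms(1) by (simp only: zt_rel_prime_power_iff)
  qed
  finally show ?thesis .
qed

lemma twin_representatives_subset:
  assumes "m > 0"
  shows "twin_representatives m \<subseteq> nonzero_nonunits m"
proof
  fix d
  assume "d \<in> twin_representatives m"
  then have d: "d dvd m" "d \<noteq> 1" "d \<noteq> m"
    by (auto simp: twin_representatives_def)
  then have "0 < d" "d < m"
    using assms dvd_imp_le[of d m] by (auto intro: Nat.gr0I)
  with d show "d \<in> nonzero_nonunits m"
    by (simp add: nonzero_nonunits_def coprime_absorb_left)
qed

text \<open>The representative of \<open>a\<close> is \<open>gcd a m\<close>, or \<open>p ^ (k - 1)\<close> if \<open>gcd a m\<close> is a full prime power \<open>p ^ k\<close>.
  As \<open>k \<ge> 2\<close>, that is neither \<open>1\<close> nor again a full prime power.\<close>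

lemma ex_twin_representative:
  assumes "m > 0" and sq: "\<And>p. prime p \<Longrightarrow> p dvd m \<Longrightarrow> p ^ 2 dvd m"
    and a: "a \<in> nonzero_nonunits m"
  shows "\<exists>k \<in> twin_representatives m. \<forall>b. zt_rel m k b \<longleftrightarrow> zt_rel m a b"
proof -
  define g where "g = gcd a m"
  have g: "g dvd m" "g \<noteq> 1" "g \<noteq> m"
  proof -
    show "g dvd m"
      by (simp add: g_def)
    have "\<not> coprime a m"
      using a by (simp add: nonzero_nonunits_def)
    then show "g \<noteq> 1"
      unfolding g_def coprime_iff_gcd_eq_1 .
    have "g dvd a"
      by (simp add: g_def)
    then show "g \<noteq> m"
      using a by (auto simp: nonzero_nonunits_def dest: dvd_imp_le)
  qed
  have rel: "zt_rel m a b \<longleftrightarrow> zt_rel m g b" for b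
    by (simp add: g_def zt_rel_gcd_left)
  show ?thesis
  proof (cases "g \<in> full_prime_powers m")
    case False
    with g rel show ?thesis
      by (intro bexI[of _ g]) (auto simp: twin_representatives_def)
  next
    case True
    then obtain p where p: "prime p" "p dvd m" "g = p ^ multiplicity p m"
      by (auto simp: full_prime_powers_def in_prime_factors_iff)
    have "2 \<le> multiplicity p m"
      using sq[OF p(1,2)] p(1) assms(1) by (intro multiplicity_geI) auto
    then obtain k where k: "multiplicity p m = Suc (Suc k)"
      by (metis Suc_le_D numeral_2_eq_2 Suc_le_mono)
    obtain c where c: "m = p ^ multiplicity p m * c" "\<not> p dvd c"
      using multiplicity_decompose'[of m p] assms(1) p(1) by (metis not_gr_zero not_prime_unit)
    have cop: "coprime p c"
      using c(2) p(1) prime_imp_coprime by blast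
    have p1: "p > 1"
      using p(1) prime_gt_1_nat by blast
    have "p ^ Suc k \<in> twin_representatives m"
    proof -
      have "p ^ Suc k dvd m"
        using c(1) k by (metis dvd_mult2 le_imp_power_dvd lessI less_imp_le)
      moreover have "p ^ Suc k < m"
      proof -
        have "p ^ Suc k < g"
          using p(3) k p1 by (simp only: power_strict_increasing_iff)
        also have "\<dots> \<le> m"
          using g(1) assms(1) by (rule dvd_imp_le)
        finally show ?thesis .
      qed
      moreover have "p ^ Suc k \<noteq> 1"
        using p1 by simp
      moreover have "p ^ Suc k \<notin> full_prime_powers m"
      proof
        assume "p ^ Suc k \<in> full_prime_powers m"
        then obtain q where q: "prime q" "p ^ Suc k = q ^ multiplicity q m"
          by (auto simp: full_prime_powers_def)
        then have "q = p"
          using p(1) by (metis dvd_power prime_dvd_power primes_dvd_imp_eq zero_less_Suc)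
        with q k p1 show False
          by simp
      qed
      ultimately show ?thesis
        by (simp add: twin_representatives_def)
    qed
    moreover have "zt_rel m (p ^ Suc k) b \<longleftrightarrow> zt_rel m a b" for b
      using zt_rel_full_prime_power[of p m k c b] p c(1) cop k rel by simp
    ultimately show ?thesis
      by blast
  qed
qed

lemma prime_factors_singleton_imp_power:
  fixes x :: nat
  assumes "x > 0" "prime_factors x = {q}"
  shows "x = q ^ multiplicity q x"
  using prod_prime_factors[of x] assms by simp

text \<open>With \<open>c = m div e'\<close>, a multiple of \<open>c\<close> is what annihilates \<open>e'\<close>, and \<open>c\<close> does not annihilate \<open>e\<close>
  because \<open>e'\<close> does not divide \<open>e\<close>. So \<open>g = c\<close> works if it shares a prime with \<open>e'\<close>. Otherwise
  \<open>e'\<close> has at least two prime divisors, since it is not a full prime power, and \<open>g = p * c\<close> works for a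
  prime divisor \<open>p\<close> of \<open>e'\<close> other than a prime \<open>q\<close> at which \<open>e\<close> falls short of \<open>e'\<close>.

  The condition \<open>2 * g \<noteq> m\<close> makes \<open>g\<close> and \<open>m - g\<close> different, and \<open>e' \<noteq> 2\<close> secures it in the first case.\<close>

lemma twin_representatives_separated_aux:
  assumes m: "m > 0" and sq: "\<And>p. prime p \<Longrightarrow> p dvd m \<Longrightarrow> p ^ 2 dvd m"
    and e': "e' \<in> twin_representatives m" and nd: "\<not> e' dvd e" and ne2: "e' \<noteq> 2"
  shows "\<exists>g. g dvd m \<and> 1 < g \<and> g < m \<and> 2 * g \<noteq> m \<and> \<not> zt_rel m e g \<and> zt_rel m e' g"
proof -
  have e'm: "e' dvd m" "e' \<noteq> 1" "e' \<noteq> m" "e' \<notin> full_prime_powers m"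
    using e' by (auto simp: twin_representatives_def)
  then obtain c where mc: "m = e' * c"
    by auto
  have pos: "e' > 0" "c > 0"
    using m mc by auto
  have c1: "c \<noteq> 1"
    using mc e'm(3) by auto
  show ?thesis
  proof (cases "coprime e' c")
    case False
    have "\<not> m dvd e * c"
      using nd mc pos by simp
    then have "\<not> zt_rel m e c"
      by (simp add: zt_rel_def)
    moreover have "zt_rel m e' c"
    proof -
      have "\<not> coprime (gcd e' c) m"
        using False mc by (metis coprime_absorb_left dvd_mult gcd_dvd2 is_unit_gcd)
      then show ?thesis
        using mc by (simp add: zt_rel_def)
    qed
    moreover have "2 * c \<noteq> m"
      using mc ne2 pos by auto
    moreover have "1 < c" "c < m"
      using mc pos c1 e'm(2) by (auto simp: nat_neq_iff)
    ultimately show ?thesis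
      using mc by (intro exI[of _ c]) auto
  next
    case True
    have "\<exists>q. prime q \<and> multiplicity q e < multiplicity q e'"
    proof (rule ccontr)
      assume "\<not> ?thesis"
      then have "multiplicity p e' \<le> multiplicity p e" if "prime p" for p
        using that not_le by blast
      then have "e' dvd e"
        using pos by (intro multiplicity_le_imp_dvd) auto
      with nd show False ..
    qed
    then obtain q where q: "prime q" "multiplicity q e < multiplicity q e'"
      by blast
    then have qe': "q dvd e'"
      by (metis gr_implies_not0 not_dvd_imp_multiplicity_0)
    \<comment> \<open>A power of \<open>q\<close> coprime to its cofactor \<open>c\<close> would be the full power of \<open>q\<close> in \<open>m\<close>.\<close>
    have "\<exists>p. prime p \<and> p dvd e' \<and> p \<noteq> q"
    proof (rule ccontr)
      assume "\<not> ?thesis"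
      then have "r = q" if "prime r" "r dvd e'" for r
        using that by blast
      then have "prime_factors e' = {q}"
        using q(1) qe' pos(1) unfolding set_eq_iff in_prime_factors_iff by blast
      then have pw: "e' = q ^ multiplicity q e'"
        using pos prime_factors_singleton_imp_power by blast
      have "\<not> q dvd c"
        using True qe' q(1) by (meson coprime_common_divisor not_prime_unit)
      then have "multiplicity q m = multiplicity q e'"
        using mc pos q(1) by (simp add: prime_elem_multiplicity_mult_distrib not_dvd_imp_multiplicity_0)
      then have "e' = q ^ multiplicity q m"
        using pw by (simp only:)
      moreover have "q \<in> prime_factors m"
        using q(1) dvd_trans[OF qe' e'm(1)] m by (simp add: in_prime_factors_iff)
      ultimately have "e' \<in> full_prime_powers m"
        unfolding full_prime_powers_def by (rule image_eqI)
      with e'm(4) show False by simp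
    qed
    then obtain p where p: "prime p" "p dvd e'" "p \<noteq> q"
      by blast
    have p1: "p > 1"
      using p(1) prime_gt_1_nat by blast
    let ?g = "p * c"
    have "\<not> e' dvd e * p"
    proof
      assume dvd: "e' dvd e * p"
      have "e \<noteq> 0"
        using nd by (metis dvd_0_right)
      then have "multiplicity q (e * p) = multiplicity q e + multiplicity q p"
        using q(1) p1 by (intro prime_elem_multiplicity_mult_distrib) auto
      also have "multiplicity q p = 0"
        using p q(1) by (intro not_dvd_imp_multiplicity_0) (auto dest: primes_dvd_imp_eq)
      finally have "multiplicity q e' \<le> multiplicity q e"
        using dvd_imp_multiplicity_le[OF dvd, of q] \<open>e \<noteq> 0\<close> p1 by simp
      with q(2) show False by simp
    qed
    then have "\<not> m dvd e * ?g"
      using mc pos by (simp flip: mult.assoc)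
    then have "\<not> zt_rel m e ?g"
      by (simp add: zt_rel_def)
    moreover have "zt_rel m e' ?g"
    proof -
      have "p dvd gcd e' ?g" "p dvd m"
        using p(2) mc by auto
      then have "\<not> coprime (gcd e' ?g) m"
        using p(1) by (meson coprime_common_divisor not_prime_unit)
      then show ?thesis
        using mc by (simp add: zt_rel_def)
    qed
    moreover have "2 * ?g \<noteq> m"
    proof
      assume "2 * ?g = m"
      \<comment> \<open>Then \<open>e'\<close> has a single factor \<open>2\<close> and \<open>c\<close> is odd, although \<open>4\<close> divides \<open>m\<close>.\<close>
      then have e'2: "e' = 2 * p"
        using mc pos by simp
      then have "q = 2"
        using qe' q(1) p by (metis prime_dvd_mult_iff primes_dvd_imp_eq two_is_prime_nat)
      have "2 ^ 2 dvd m"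
        using sq[of 2] mc e'2 by simp
      then have "2 dvd p * c"
        using mc e'2 by (auto simp: power2_eq_square)
      moreover have "\<not> 2 dvd p"
        using p \<open>q = 2\<close> q(1) primes_dvd_imp_eq by blast
      moreover have "\<not> 2 dvd c"
        using True e'2 by auto
      ultimately show False
        by auto
    qed
    moreover have "p < e'"
      using p q(1) qe' pos by (metis dvd_imp_le le_neq_implies_less primes_dvd_imp_eq)
    then have "?g < m"
      using mc pos by simp
    moreover have "1 < ?g"
      using p1 pos by (metis less_le_trans mult.right_neutral nat_mult_le_cancel1 One_nat_def Suc_leI less_trans zero_less_one)
    moreover have "?g dvd m"
      using p(2) mc by simp
    ultimately show ?thesis
      by blast
  qed
qed

text \<open>The separating vertex must not be a representative itself. If the divisor \<open>g\<close> separates, then so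
  does \<open>m - g\<close>, which has the same gcd with \<open>m\<close>, and \<open>m - g\<close> divides \<open>m\<close> only if \<open>2 * g = m\<close>. Swapping \<open>e\<close>
  and \<open>e'\<close> if necessary, one can arrange both that \<open>e'\<close> does not divide \<open>e\<close> and that \<open>e' \<noteq> 2\<close>.\<close>

lemma twin_representatives_separated:
  assumes m: "m > 0" and sq: "\<And>p. prime p \<Longrightarrow> p dvd m \<Longrightarrow> p ^ 2 dvd m"
    and e: "e \<in> twin_representatives m" "e' \<in> twin_representatives m" "e \<noteq> e'"
  shows "\<exists>s \<in> nonzero_nonunits m - twin_representatives m. zt_rel m e s \<noteq> zt_rel m e' s"
proof -
  have "\<exists>g. g dvd m \<and> 1 < g \<and> g < m \<and> 2 * g \<noteq> m \<and> zt_rel m e g \<noteq> zt_rel m e' g"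
  proof (cases "\<not> e' dvd e \<and> e' \<noteq> 2")
    case True
    then show ?thesis
      using twin_representatives_separated_aux[OF m sq e(2)] by blast
  next
    case False
    have "e \<noteq> 1" "e' \<noteq> 1"
      using e by (auto simp: twin_representatives_def)
    then have "\<not> e dvd e' \<and> e \<noteq> 2"
      using False e(3) by (metis dvd_antisym prime_nat_iff two_is_prime_nat)
    then show ?thesis
      using twin_representatives_separated_aux[OF m sq e(1)] by blast
  qed
  then obtain g where g: "g dvd m" "1 < g" "g < m" "2 * g \<noteq> m" "zt_rel m e g \<noteq> zt_rel m e' g"
    by blast
  have gcd: "gcd (m - g) m = g"
    using g gcd_diff2_nat[of g m] by (simp add: gcd_nat.absorb1)
  have "zt_rel m x (m - g) \<longleftrightarrow> zt_rel m x g" for x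
    using zt_rel_gcd_left[of m "m - g" x] by (simp add: gcd zt_rel_commute)
  moreover have "m - g \<in> nonzero_nonunits m"
  proof -
    have "\<not> coprime (m - g) m"
    proof
      assume "coprime (m - g) m"
      then have "gcd (m - g) m = 1"
        by (rule coprime_imp_gcd_eq_1)
      with gcd g(2) show False
        by linarith
    qed
    then show ?thesis
      using g(2,3) by (simp add: nonzero_nonunits_def)
  qed
  moreover have "m - g \<notin> twin_representatives m"
  proof
    assume "m - g \<in> twin_representatives m"
    then have "m - g dvd m"
      by (simp add: twin_representatives_def)
    then have "m - g = g"
      using gcd by (simp add: gcd_nat.absorb1)
    with g show False by simp
  qed
  ultimately show ?thesis
    using g(5) by auto
qed

section \<open>Counting\<close>

lemma card_nonzero_nonunits:
  assumes "m \<ge> 2"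
  shows "int (card (nonzero_nonunits m)) = int m - 1 - int (totient m)"
proof -
  have eq: "nonzero_nonunits m = {0<..<m} - totatives m"
    by (auto simp: nonzero_nonunits_def totatives_def)
  have sub: "totatives m \<subseteq> {0<..<m}"
    using assms totatives_less by (auto simp: totatives_def)
  have "card (nonzero_nonunits m) = card {0<..<m} - card (totatives m)"
    unfolding eq using sub by (intro card_Diff_subset) auto
  moreover have "card (totatives m) \<le> card {0<..<m}"
    using sub by (intro card_mono) auto
  ultimately show ?thesis
    using assms by (simp add: totient_def)
qed

lemma card_full_prime_powers: "card (full_prime_powers m) = card (prime_factors m)"
proof -
  have "inj_on (\<lambda>p. p ^ multiplicity p m) (prime_factors m)"
  proof (rule inj_onI)
    fix p q
    assume p: "p \<in> prime_factors m" and q: "q \<in> prime_factors m"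
      and eq: "p ^ multiplicity p m = q ^ multiplicity q m"
    have "multiplicity p m > 0"
      using p by (auto simp: prime_factors_multiplicity)
    then have "p dvd q ^ multiplicity q m"
      using eq by (metis dvd_power)
    then show "p = q"
      using p q by (metis in_prime_factors_imp_prime prime_dvd_power primes_dvd_imp_eq)
  qed
  then show ?thesis
    by (simp add: full_prime_powers_def card_image)
qed

lemma self_mem_full_prime_powers_iff:
  assumes "m \<ge> 2"
  shows "m \<in> full_prime_powers m \<longleftrightarrow> card (prime_factors m) = 1"
proof
  assume "m \<in> full_prime_powers m"
  then obtain p where p: "prime p" "p dvd m" "m = p ^ multiplicity p m"
    by (auto simp: full_prime_powers_def in_prime_factors_iff)
  have "prime_factors m = {p}"
  proof (intro Set.set_eqI iffI)
    fix r
    assume "r \<in> prime_factors m"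
    then have r: "prime r" "r dvd m"
      by (auto simp: in_prime_factors_iff)
    with p(3) have "r dvd p"
      by (metis prime_dvd_power)
    with r p(1) show "r \<in> {p}"
      by (simp add: primes_dvd_imp_eq)
  next
    fix r
    assume "r \<in> {p}"
    with p(1,2) assms show "r \<in> prime_factors m"
      by (simp add: in_prime_factors_iff)
  qed
  then show "card (prime_factors m) = 1"
    by simp
next
  assume "card (prime_factors m) = 1"
  then obtain p where p: "prime_factors m = {p}"
    by (rule card_1_singletonE)
  then show "m \<in> full_prime_powers m"
    using prime_factors_singleton_imp_power[OF _ p] assms by (simp add: full_prime_powers_def)
qed

text \<open>The excluded divisors \<open>1\<close>, \<open>m\<close> and the full prime powers are all different unless \<open>m\<close> is a prime
  power; in that case \<open>m\<close> is the only full prime power.\<close>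

lemma card_twin_representatives:
  assumes "m \<ge> 2"
  shows "int (card (twin_representatives m)) = int (card {d. d dvd m}) - 2
           - (if card (prime_factors m) \<ge> 2 then int (card (prime_factors m)) else 0)"
proof -
  let ?n = "card (prime_factors m)"
  let ?X = "{1, m} \<union> full_prime_powers m"
  have fin: "finite {d. d dvd m}"
    using assms by (intro finite_divisors_nat) auto
  have sub: "?X \<subseteq> {d. d dvd m}"
    by (auto simp: full_prime_powers_def multiplicity_dvd)
  have one: "1 \<notin> full_prime_powers m"
  proof
    assume "1 \<in> full_prime_powers m"
    then obtain p where p: "prime p" "multiplicity p m > 0" "1 = p ^ multiplicity p m"
      by (auto simp: full_prime_powers_def prime_factors_multiplicity)
    then have "p dvd 1"
      by (metis dvd_power)
    with p(1) show False
      using not_prime_unit by blast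
  qed
  have npos: "?n \<noteq> 0"
    using assms by (simp add: prime_factorization_empty_iff)
  have finX: "finite (full_prime_powers m)"
    by (simp add: full_prime_powers_def)
  have cX: "card ?X = (if ?n \<ge> 2 then ?n + 2 else 2)"
  proof (cases "?n \<ge> 2")
    case True
    then have "m \<notin> full_prime_powers m"
      using self_mem_full_prime_powers_iff[OF assms] by simp
    with one finX assms True show ?thesis
      by (simp add: card_full_prime_powers)
  next
    case False
    with npos have n1: "?n = 1"
      by linarith
    then have "full_prime_powers m = {m}"
      using self_mem_full_prime_powers_iff[OF assms] card_full_prime_powers[of m]
      by (metis card_1_singletonE singletonD)
    then have "?X = {1, m}"
      by auto
    with assms False show ?thesis
      by simp
  qed
  have "twin_representatives m = {d. d dvd m} - ?X"
    by (auto simp: twin_representatives_def)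
  then have "card (twin_representatives m) = card {d. d dvd m} - card ?X"
    using sub fin by (simp only: card_Diff_subset finite_subset)
  moreover have "card ?X \<le> card {d. d dvd m}"
    using sub fin by (intro card_mono)
  ultimately show ?thesis
    using cX by (auto split: if_splits)
qed

theorem proposition4p5:
  fixes m n :: nat
  assumes "m \<ge> 2"
    and "n = card (prime_factors m)"
    and "Digraph_Component.connected
           (with_proj (total_zero_divisor_graph (residue_ring (int m))))"
  shows "int (metric_dimension (with_proj (total_zero_divisor_graph (residue_ring (int m))))) =
           (if n \<ge> 2
            then int m - int (totient m) - int (card {d. d dvd m}) + int n + 1
            else int m - int (totient m) - int (card {d. d dvd m}) + 1)"
proof -
  let ?G = "total_zero_divisor_graph (residue_ring (int m))"
  let ?V = "nonzero_nonunits m" and ?K = "twin_representatives m"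
  interpret pair_graph ?G
    using assms(1) by (rule pair_graph_residue_ring)
  have mpos: "m > 0"
    using assms(1) by simp
  note sq = connected_imp_prime_square_dvd[OF assms(1,3)]
  note V = pverts_residue_ring[OF assms(1)]
  note arc = parcs_residue_ring[OF assms(1)]
  note KV = twin_representatives_subset[OF mpos]
  have "metric_dimension ?G = card (pverts ?G) - card (int ` ?K)"
  proof (rule metric_dimension_twin_transversal[where f = "\<lambda>x. {b. zt_rel m (nat x) b}"])
    fix u v
    assume uv: "u \<in> pverts ?G" "v \<in> pverts ?G"
      "{b. zt_rel m (nat u) b} = {b. zt_rel m (nat v) b}"
    then obtain a b where ab: "u = int a" "v = int b" "a \<in> ?V" "b \<in> ?V"
      by (auto simp: V)
    have eq: "zt_rel m a c \<longleftrightarrow> zt_rel m b c" for c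
      using uv(3) ab by (auto simp: set_eq_iff)
    have "(u, x) \<in> parcs ?G \<longleftrightarrow> (v, x) \<in> parcs ?G" if "x \<noteq> u" "x \<noteq> v" for x
    proof (cases "x \<in> pverts ?G")
      case True
      then show ?thesis
        using ab that eq by (auto simp: V arc)
    next
      case False
      then show ?thesis
        using in_arcsD2 by blast
    qed
    then show "twins u v"
      by (simp add: twins_def)
  next
    show "int ` ?K \<subseteq> pverts ?G"
      using KV by (auto simp: V)
  next
    show "(\<lambda>x. {b. zt_rel m (nat x) b}) ` pverts ?G \<subseteq> (\<lambda>x. {b. zt_rel m (nat x) b}) ` int ` ?K"
    proof (clarsimp simp: V)
      fix a
      assume "a \<in> ?V"
      from ex_twin_representative[OF mpos sq this]
      show "{b. zt_rel m a b} \<in> (\<lambda>x. {b. zt_rel m (nat x) b}) ` int ` ?K"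
        by (auto simp: image_iff)
    qed
  next
    fix u v
    assume "u \<in> int ` ?K" "v \<in> int ` ?K" "u \<noteq> v"
    then obtain e e' where e: "u = int e" "v = int e'" "e \<in> ?K" "e' \<in> ?K" "e \<noteq> e'"
      by auto
    from twin_representatives_separated[OF mpos sq e(3-5)]
    obtain s where s: "s \<in> ?V" "s \<notin> ?K" "zt_rel m e s \<noteq> zt_rel m e' s"
      by auto
    then have "((u, int s) \<in> parcs ?G) \<noteq> ((v, int s) \<in> parcs ?G)"
      using e KV by (auto simp: arc subset_iff)
    with s show "\<exists>s\<in>pverts ?G - int ` ?K. ((u, s) \<in> parcs ?G) \<noteq> ((v, s) \<in> parcs ?G)"
      by (intro bexI[of _ "int s"]) (auto simp: V)
  qed
  also have "\<dots> = card ?V - card ?K"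
    by (simp add: V card_image)
  finally have "metric_dimension ?G = card ?V - card ?K" .
  moreover have "card ?K \<le> card ?V"
    using KV by (intro card_mono) (auto simp: nonzero_nonunits_def)
  ultimately show ?thesis
    using card_nonzero_nonunits[OF assms(1)] card_twin_representatives[OF assms(1)] assms(2)
    by simp
qed

end
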